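(* Every stepping-up loop is diassociative.
   Context: A loop $(Q,\cdot,\backslash,/,1)$ is a set $Q$ with binary operations $\cdot,\backslash,/$ and an element $1$ such that $x\backslash(x\cdot y)=y=(y\cdot x)/x$, $x\cdot(x\backslash y)=y=(y/x)\cdot x$ and $1\cdot x=x=x\cdot 1$ for all $x,y\in Q$. A loop has the inverse property (IP) if $1/x=x\backslash 1$ for all $x$ (the common value being denoted $x^{-1}$) and $x^{-1}\cdot(x\cdot y)=y=(y\cdot x)\cdot x^{-1}$ for all $x,y$. A loop is alternative if $x\cdot(x\cdot y)=(x\cdot x)\cdot y$ and $(x\cdot y)\cdot y=x\cdot(y\cdot y)$ for all $x,y$. It is flexible if $x\cdot(y\cdot x)=(x\cdot y)\cdot x$ for all $x,y$. In an IP loop $Q$, a subset $X\subseteq Q$ strongly associates if $u\cdot(v\cdot w)=(u\cdot v)\cdot w$ for all $u,v,w\in X\cup X^{-1}$, where $X^{-1}=\{x^{-1}:x\in X\}$. For $x,y,z\in Q$ (not necessarily distinct), $\mathit{SA}(x,y,z)$ denotes the statement that $\{x,y,z\}$ strongly associates. A stepping-up loop is an alternative, flexible IP loop $Q$ such that for all $x,y,z\in Q$, $\mathit{SA}(x,y,z)$ implies $\mathit{SA}(x,y,y\cdot z)$. A loop is diassociative if for any two of its elements the subloop they generate is a group (i.e. is associative). *)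

theory Defs
  imports "HOL-Algebra.Group"
begin

record 'a loop = "'a monoid" +
  ldiv :: "['a, 'a] \<Rightarrow> 'a" (infixl "\<setminus>\<index>" 70)
  rdiv :: "['a, 'a] \<Rightarrow> 'a" (infixl "\<oslash>\<index>" 70)

locale loop =
  fixes Q (structure)
  assumes mult_closed: "\<lbrakk>x \<in> carrier Q; y \<in> carrier Q\<rbrakk> \<Longrightarrow> x \<otimes> y \<in> carrier Q"
    and ldiv_closed: "\<lbrakk>x \<in> carrier Q; y \<in> carrier Q\<rbrakk> \<Longrightarrow> x \<setminus> y \<in> carrier Q"
    and rdiv_closed: "\<lbrakk>x \<in> carrier Q; y \<in> carrier Q\<rbrakk> \<Longrightarrow> x \<oslash> y \<in> carrier Q"
    and one_closed: "\<one> \<in> carrier Q"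
    and ldiv_mult: "\<lbrakk>x \<in> carrier Q; y \<in> carrier Q\<rbrakk> \<Longrightarrow> x \<setminus> (x \<otimes> y) = y"
    and rdiv_mult: "\<lbrakk>x \<in> carrier Q; y \<in> carrier Q\<rbrakk> \<Longrightarrow> (y \<otimes> x) \<oslash> x = y"
    and mult_ldiv: "\<lbrakk>x \<in> carrier Q; y \<in> carrier Q\<rbrakk> \<Longrightarrow> x \<otimes> (x \<setminus> y) = y"
    and mult_rdiv: "\<lbrakk>x \<in> carrier Q; y \<in> carrier Q\<rbrakk> \<Longrightarrow> (y \<oslash> x) \<otimes> x = y"
    and one_mult: "x \<in> carrier Q \<Longrightarrow> \<one> \<otimes> x = x"
    and mult_one: "x \<in> carrier Q \<Longrightarrow> x \<otimes> \<one> = x"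

text \<open>The right inverse of \<open>x\<close>. It is used only in inverse property loops, where it
  coincides with the left inverse.\<close>

definition loop_inv :: "('a, 'b) loop_scheme \<Rightarrow> 'a \<Rightarrow> 'a"
  where "loop_inv Q x = x \<setminus>\<^bsub>Q\<^esub> \<one>\<^bsub>Q\<^esub>"

locale ip_loop = loop +
  assumes two_sided_inv: "x \<in> carrier Q \<Longrightarrow> \<one> \<oslash> x = x \<setminus> \<one>"
    and left_ip: "\<lbrakk>x \<in> carrier Q; y \<in> carrier Q\<rbrakk> \<Longrightarrow> loop_inv Q x \<otimes> (x \<otimes> y) = y"
    and right_ip: "\<lbrakk>x \<in> carrier Q; y \<in> carrier Q\<rbrakk> \<Longrightarrow> (y \<otimes> x) \<otimes> loop_inv Q x = y"

definition alternative :: "('a, 'b) loop_scheme \<Rightarrow> bool"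
  where "alternative Q \<longleftrightarrow>
    (\<forall>x\<in>carrier Q. \<forall>y\<in>carrier Q.
      x \<otimes>\<^bsub>Q\<^esub> (x \<otimes>\<^bsub>Q\<^esub> y) = (x \<otimes>\<^bsub>Q\<^esub> x) \<otimes>\<^bsub>Q\<^esub> y \<and>
      (x \<otimes>\<^bsub>Q\<^esub> y) \<otimes>\<^bsub>Q\<^esub> y = x \<otimes>\<^bsub>Q\<^esub> (y \<otimes>\<^bsub>Q\<^esub> y))"

definition flexible :: "('a, 'b) loop_scheme \<Rightarrow> bool"
  where "flexible Q \<longleftrightarrow>
    (\<forall>x\<in>carrier Q. \<forall>y\<in>carrier Q.
      x \<otimes>\<^bsub>Q\<^esub> (y \<otimes>\<^bsub>Q\<^esub> x) = (x \<otimes>\<^bsub>Q\<^esub> y) \<otimes>\<^bsub>Q\<^esub> x)"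

definition strongly_associates :: "('a, 'b) loop_scheme \<Rightarrow> 'a set \<Rightarrow> bool"
  where "strongly_associates Q X \<longleftrightarrow>
    (\<forall>u \<in> X \<union> loop_inv Q ` X. \<forall>v \<in> X \<union> loop_inv Q ` X. \<forall>w \<in> X \<union> loop_inv Q ` X.
      u \<otimes>\<^bsub>Q\<^esub> (v \<otimes>\<^bsub>Q\<^esub> w) = (u \<otimes>\<^bsub>Q\<^esub> v) \<otimes>\<^bsub>Q\<^esub> w)"

abbreviation SA :: "('a, 'b) loop_scheme \<Rightarrow> 'a \<Rightarrow> 'a \<Rightarrow> 'a \<Rightarrow> bool"
  where "SA Q x y z \<equiv> strongly_associates Q {x, y, z}"

locale stepping_up_loop = ip_loop +
  assumes alternative: "alternative Q"
    and flexible: "flexible Q"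
    and step_up: "\<lbrakk>x \<in> carrier Q; y \<in> carrier Q; z \<in> carrier Q; SA Q x y z\<rbrakk>
      \<Longrightarrow> SA Q x y (y \<otimes> z)"

definition subloop :: "'a set \<Rightarrow> ('a, 'b) loop_scheme \<Rightarrow> bool"
  where "subloop H Q \<longleftrightarrow> H \<subseteq> carrier Q \<and> \<one>\<^bsub>Q\<^esub> \<in> H \<and>
    (\<forall>x\<in>H. \<forall>y\<in>H. x \<otimes>\<^bsub>Q\<^esub> y \<in> H \<and> x \<setminus>\<^bsub>Q\<^esub> y \<in> H \<and> x \<oslash>\<^bsub>Q\<^esub> y \<in> H)"

definition generated_subloop :: "('a, 'b) loop_scheme \<Rightarrow> 'a set \<Rightarrow> 'a set"
  where "generated_subloop Q X = \<Inter>{H. subloop H Q \<and> X \<subseteq> H}"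

definition diassociative :: "('a, 'b) loop_scheme \<Rightarrow> bool"
  where "diassociative Q \<longleftrightarrow>
    (\<forall>x\<in>carrier Q. \<forall>y\<in>carrier Q. group (Q\<lparr>carrier := generated_subloop Q {x, y}\<rparr>))"

end

theory Submission
  imports Defs
begin

text \<open>
  Fix two elements \<open>x\<close> and \<open>y\<close> and evaluate words over the letters
  \<open>x\<close>, \<open>y\<close> and their inverses by bracketing to the right. The claim is that
  evaluation turns concatenation into multiplication
  (\<open>word_value_append\<close>). The values of words then form an associative subloop, and this
  subloop contains the one generated by \<open>x\<close> and \<open>y\<close>.

  Suppose that evaluation is multiplicative for total length at most \<open>n\<close>. Then any three
  words of total length at most \<open>n\<close> have values that strongly associate
  (\<open>SA_word_values\<close>): a product of three factors that come from different words is
  covered by the hypothesis, and if two of the factors come from the same word, then the alternative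
  laws, the flexible law and the inverse property suffice.

  To pass from \<open>n\<close> to \<open>n + 1\<close> (\<open>multiplicative_Suc\<close>), let
  \<open>p\<close> and \<open>q\<close> be the first and the last letter of the left factor and
  \<open>r\<close> the last letter of the right factor. There are only two generators, so two of
  these three letters are equal or inverse to each other. Remove the later letter of such a pair. What
  is left has total length \<open>n\<close>, so it splits into three words with strongly associating
  values, one of them being the earlier letter of the pair. The removed letter, which is this element
  or its inverse, can be put back by stepping up. The resulting associativity either moves the first
  letter out of the left factor, which leaves a product of total length \<open>n\<close>, or shifts
  the cut between the two factors one place to the left, so that induction on the length of the left
  factor applies.
\<close>

section \<open>Inverse property loops and strong association\<close>

definition associates :: "('a, 'b) loop_scheme \<Rightarrow> 'a \<Rightarrow> 'a \<Rightarrow> 'a \<Rightarrow> bool"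
  where "associates Q u v w \<longleftrightarrow> u \<otimes>\<^bsub>Q\<^esub> (v \<otimes>\<^bsub>Q\<^esub> w) = (u \<otimes>\<^bsub>Q\<^esub> v) \<otimes>\<^bsub>Q\<^esub> w"

definition signs :: "('a, 'b) loop_scheme \<Rightarrow> 'a \<Rightarrow> 'a set"
  where "signs Q a = {a, loop_inv Q a}"

context ip_loop
begin

lemma inv_closed: "x \<in> carrier Q \<Longrightarrow> loop_inv Q x \<in> carrier Q"
  by (simp add: loop_inv_def ldiv_closed one_closed)

lemma mult_inv: "x \<in> carrier Q \<Longrightarrow> x \<otimes> loop_inv Q x = \<one>"
  by (simp add: loop_inv_def mult_ldiv one_closed)

lemma inv_mult: "x \<in> carrier Q \<Longrightarrow> loop_inv Q x \<otimes> x = \<one>"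
  using left_ip[of x \<one>] by (simp add: one_closed mult_one)

lemma inv_inv: assumes "x \<in> carrier Q" shows "loop_inv Q (loop_inv Q x) = x"
  using left_ip[of "loop_inv Q x" x] assms by (simp add: inv_closed inv_mult mult_one)

lemma inv_one: "loop_inv Q \<one> = \<one>"
  using mult_inv[of \<one>] by (simp add: one_closed one_mult inv_closed)

lemma mult_inv_cancel_left: "\<lbrakk>x \<in> carrier Q; y \<in> carrier Q\<rbrakk> \<Longrightarrow> x \<otimes> (loop_inv Q x \<otimes> y) = y"
  using left_ip[of "loop_inv Q x" y] by (simp add: inv_closed inv_inv)

lemma mult_inv_cancel_right: "\<lbrakk>x \<in> carrier Q; y \<in> carrier Q\<rbrakk> \<Longrightarrow> (y \<otimes> loop_inv Q x) \<otimes> x = y"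
  using right_ip[of "loop_inv Q x" y] by (simp add: inv_closed inv_inv)

lemma inv_of_mult:
  assumes x: "x \<in> carrier Q" and y: "y \<in> carrier Q"
  shows "loop_inv Q (x \<otimes> y) = loop_inv Q y \<otimes> loop_inv Q x"
proof -
  let ?z = "x \<otimes> y"
  have z: "?z \<in> carrier Q" using x y by (rule mult_closed)
  have "y \<otimes> loop_inv Q ?z = (loop_inv Q x \<otimes> ?z) \<otimes> loop_inv Q ?z"
    using left_ip[OF x y] by simp
  also have "\<dots> = loop_inv Q x"
    using z x by (simp add: right_ip inv_closed)
  finally have "loop_inv Q y \<otimes> (y \<otimes> loop_inv Q ?z) = loop_inv Q y \<otimes> loop_inv Q x" by simp
  then show ?thesis using y z by (simp add: left_ip inv_closed)
qed

lemma ldiv_eq: assumes "x \<in> carrier Q" "y \<in> carrier Q" shows "x \<setminus> y = loop_inv Q x \<otimes> y"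
  using ldiv_mult[of x "loop_inv Q x \<otimes> y"] assms
  by (simp add: mult_inv_cancel_left inv_closed mult_closed)

lemma rdiv_eq: assumes "x \<in> carrier Q" "y \<in> carrier Q" shows "y \<oslash> x = y \<otimes> loop_inv Q x"
  using rdiv_mult[of x "y \<otimes> loop_inv Q x"] assms
  by (simp add: mult_inv_cancel_right inv_closed mult_closed)

lemma signs_closed: "\<lbrakk>a \<in> carrier Q; b \<in> signs Q a\<rbrakk> \<Longrightarrow> b \<in> carrier Q"
  by (auto simp: signs_def inv_closed)

lemma signs_eq: "\<lbrakk>a \<in> carrier Q; b \<in> signs Q a\<rbrakk> \<Longrightarrow> signs Q b = signs Q a"
  by (auto simp: signs_def inv_inv)

text \<open>
  In this form strong association visibly depends only on the sets \<open>signs Q a\<close>, so an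
  element of the triple may be exchanged for its inverse.
\<close>

lemma strongly_associates_iff:
  "strongly_associates Q X \<longleftrightarrow>
    (\<forall>u \<in> (\<Union>a\<in>X. signs Q a). \<forall>v \<in> (\<Union>a\<in>X. signs Q a). \<forall>w \<in> (\<Union>a\<in>X. signs Q a). associates Q u v w)"
proof -
  have "X \<union> loop_inv Q ` X = (\<Union>a\<in>X. signs Q a)"
    by (auto simp: signs_def)
  then show ?thesis by (simp add: strongly_associates_def associates_def)
qed

lemma SA_signs:
  assumes "SA Q a b c" "c \<in> carrier Q" "d \<in> signs Q c"
  shows "SA Q a b d"
  using assms signs_eq[of c d] by (simp add: strongly_associates_iff)

lemma SA_swap: "SA Q a b c \<Longrightarrow> SA Q b a c"
  by (simp add: insert_commute)

lemma SA_rotate: "SA Q a b c \<Longrightarrow> SA Q b c a"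
  by (simp add: insert_commute)

lemma SA_associates: "SA Q a b c \<Longrightarrow> associates Q a b c"
  by (simp add: strongly_associates_iff signs_def)

end

section \<open>Strongly associating triples in stepping-up loops\<close>

context stepping_up_loop
begin

text \<open>
  This is the flexible law for \<open>a\<close> and \<open>b \<otimes> loop_inv Q a\<close>, multiplied by the
  inverse of \<open>a\<close> on the right.
\<close>

lemma associates_conj:
  assumes a: "a \<in> carrier Q" and b: "b \<in> carrier Q"
  shows "associates Q a b (loop_inv Q a)"
proof -
  let ?z = "b \<otimes> loop_inv Q a"
  have z: "?z \<in> carrier Q" using a b by (simp add: mult_closed inv_closed)
  have "(a \<otimes> b) \<otimes> loop_inv Q a = (a \<otimes> (?z \<otimes> a)) \<otimes> loop_inv Q a"
    using a b by (simp add: mult_inv_cancel_right)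
  also have "\<dots> = ((a \<otimes> ?z) \<otimes> a) \<otimes> loop_inv Q a"
    using flexible a z by (simp add: flexible_def)
  also have "\<dots> = a \<otimes> ?z"
    using a z by (simp add: right_ip mult_closed)
  finally show ?thesis by (simp add: associates_def)
qed

lemma associates_two_related:
  assumes a: "a \<in> carrier Q" and b: "b \<in> carrier Q" and u: "u \<in> signs Q a" and v: "v \<in> signs Q a"
  shows "associates Q u v b" "associates Q b u v" "associates Q u b v"
proof -
  have uc: "u \<in> carrier Q" using a u by (rule signs_closed)
  have v': "v = u \<or> v = loop_inv Q u" using u v a by (auto simp: signs_def inv_inv)
  show "associates Q u v b"
    using v' uc b alternative
    by (auto simp: associates_def alternative_def mult_inv_cancel_left mult_inv one_mult)
  show "associates Q b u v"
    using v' uc b alternative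
    by (auto simp: associates_def alternative_def right_ip mult_inv mult_one)
  show "associates Q u b v"
    using v' uc b flexible associates_conj by (auto simp: associates_def flexible_def)
qed

text \<open>
  By the preceding lemma only products with exactly one factor from each of the three
  sets need to be checked.
\<close>

lemma SA_intro:
  assumes c: "a \<in> carrier Q" "b \<in> carrier Q" "c \<in> carrier Q"
    and distinct: "\<And>u v w. \<lbrakk>u \<in> signs Q a; v \<in> signs Q b; w \<in> signs Q c\<rbrakk> \<Longrightarrow>
      associates Q u v w \<and> associates Q u w v \<and> associates Q v u w \<and>
      associates Q v w u \<and> associates Q w u v \<and> associates Q w v u"
  shows "SA Q a b c"
  unfolding strongly_associates_iff
proof (intro ballI)
  let ?S = "\<Union>t\<in>{a, b, c}. signs Q t"
  fix u v w assume u: "u \<in> ?S" and v: "v \<in> ?S" and w: "w \<in> ?S"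
  obtain r where r: "r \<in> {a, b, c}" "u \<in> signs Q r" using u by blast
  obtain s where s: "s \<in> {a, b, c}" "v \<in> signs Q s" using v by blast
  obtain t where t: "t \<in> {a, b, c}" "w \<in> signs Q t" using w by blast
  have rst: "r \<in> carrier Q" "s \<in> carrier Q" "t \<in> carrier Q" using r s t c by auto
  have uvw: "u \<in> carrier Q" "v \<in> carrier Q" "w \<in> carrier Q"
    using r(2) s(2) t(2) rst by (auto intro: signs_closed)
  consider "r = s" | "s = t" | "r = t" | "r \<noteq> s" "s \<noteq> t" "r \<noteq> t" by blast
  then show "associates Q u v w"
  proof cases
    case 1
    then show ?thesis using associates_two_related(1)[of r w u v] r s rst uvw by simp
  next
    case 2
    then show ?thesis using associates_two_related(2)[of s u v w] s t rst uvw by simp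
  next
    case 3
    then show ?thesis using associates_two_related(3)[of r v u w] r t rst uvw by simp
  next
    case 4
    then show ?thesis using r s t distinct by auto
  qed
qed

text \<open>
  Conjugating the stepping-up axiom with inversion gives its mirror image, because inversion reverses
  products. Since the triple may be changed by signs, the new factor may also be the inverse of
  \<open>b\<close>.
\<close>

lemma SA_step_right:
  assumes c: "a \<in> carrier Q" "b \<in> carrier Q" "c \<in> carrier Q"
    and sa: "SA Q a b c" and d: "d \<in> signs Q b"
  shows "SA Q a b (c \<otimes> d)"
proof -
  let ?d = "loop_inv Q d" and ?c = "loop_inv Q c"
  have dc: "d \<in> carrier Q" using c(2) d by (rule signs_closed)
  have d': "?d \<in> signs Q b" using d c by (auto simp: signs_def inv_inv)
  have "SA Q a b ?c" using sa c(3) by (rule SA_signs) (simp add: signs_def)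
  then have "SA Q ?c a b" using SA_rotate by blast
  then have "SA Q ?c a ?d" using c(2) d' by (rule SA_signs)
  then have "SA Q a ?d ?c" using SA_rotate by blast
  then have "SA Q a ?d (?d \<otimes> ?c)" using step_up c dc by (simp add: inv_closed)
  moreover have "?d \<otimes> ?c = loop_inv Q (c \<otimes> d)" using c dc by (simp add: inv_of_mult)
  ultimately have "SA Q a ?d (loop_inv Q (c \<otimes> d))" by simp
  then have "SA Q a ?d (c \<otimes> d)"
    using SA_signs[of a ?d "loop_inv Q (c \<otimes> d)" "c \<otimes> d"] c dc
    by (simp add: inv_closed mult_closed signs_def inv_inv)
  then have "SA Q (c \<otimes> d) a ?d" using SA_rotate by blast
  moreover have "b \<in> signs Q ?d" unfolding signs_eq[OF c(2) d'] by (simp add: signs_def)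
  ultimately have "SA Q (c \<otimes> d) a b" using SA_signs inv_closed[OF dc] by blast
  then show ?thesis using SA_rotate by blast
qed

end

section \<open>Values of words in two elements\<close>

definition word_value :: "('a, 'b) loop_scheme \<Rightarrow> 'a list \<Rightarrow> 'a"
  where "word_value Q w = foldr (\<otimes>\<^bsub>Q\<^esub>) w \<one>\<^bsub>Q\<^esub>"

lemma word_value_simps [simp]:
  "word_value Q [] = \<one>\<^bsub>Q\<^esub>"
  "word_value Q (a # w) = a \<otimes>\<^bsub>Q\<^esub> word_value Q w"
  by (simp_all add: word_value_def)

locale two_generators = stepping_up_loop +
  fixes x y
  assumes x: "x \<in> carrier Q" and y: "y \<in> carrier Q"
begin

definition letters where "letters = signs Q x \<union> signs Q y"

lemma letters_closed: "a \<in> letters \<Longrightarrow> a \<in> carrier Q"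
  using x y by (auto simp: letters_def signs_closed)

lemma letters_inv: "a \<in> letters \<Longrightarrow> loop_inv Q a \<in> letters"
  using x y by (auto simp: letters_def signs_def inv_inv)

lemma letters_pigeonhole:
  assumes "p \<in> letters" "q \<in> letters" "r \<in> letters"
  shows "q \<in> signs Q p \<or> r \<in> signs Q p \<or> r \<in> signs Q q"
proof -
  have *: "b \<in> signs Q a" if "a \<in> signs Q z" "b \<in> signs Q z" "z \<in> carrier Q" for a b z
    using that signs_eq by blast
  show ?thesis using assms *[OF _ _ x] *[OF _ _ y] unfolding letters_def by blast
qed

lemma word_value_closed: "w \<in> lists letters \<Longrightarrow> word_value Q w \<in> carrier Q"
  by (induction w) (auto simp: one_closed mult_closed letters_closed)

definition multiplicative_upto :: "nat \<Rightarrow> bool"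
  where "multiplicative_upto n \<longleftrightarrow> (\<forall>u\<in>lists letters. \<forall>v\<in>lists letters. length u + length v \<le> n \<longrightarrow>
    word_value Q (u @ v) = word_value Q u \<otimes> word_value Q v)"

lemma multiplicative_uptoD:
  "\<lbrakk>multiplicative_upto n; u \<in> lists letters; v \<in> lists letters; length u + length v \<le> n\<rbrakk>
    \<Longrightarrow> word_value Q (u @ v) = word_value Q u \<otimes> word_value Q v"
  by (simp add: multiplicative_upto_def)

text \<open>
  The value of the formal inverse is bracketed to the right, whereas inverting the value yields a
  product bracketed to the left; comparing the two already needs multiplicativity.
\<close>

lemma inv_word_value:
  assumes n: "multiplicative_upto n"
  shows "\<lbrakk>w \<in> lists letters; length w \<le> n\<rbrakk> \<Longrightarrow>
    loop_inv Q (word_value Q w) = word_value Q (map (loop_inv Q) (rev w))"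
proof (induction w)
  case Nil
  then show ?case by (simp add: inv_one)
next
  case (Cons a w)
  let ?w = "map (loop_inv Q) (rev w)"
  have a: "a \<in> letters" and w: "w \<in> lists letters" using Cons.prems by auto
  have w': "?w \<in> lists letters" using w by (auto simp: letters_inv)
  have "loop_inv Q (word_value Q (a # w)) = word_value Q ?w \<otimes> loop_inv Q a"
    using Cons a w by (simp add: inv_of_mult letters_closed word_value_closed)
  also have "\<dots> = word_value Q ?w \<otimes> word_value Q [loop_inv Q a]"
    using a by (simp add: mult_one letters_closed inv_closed)
  also have "\<dots> = word_value Q (?w @ [loop_inv Q a])"
    using multiplicative_uptoD[OF n w', of "[loop_inv Q a]"] a Cons.prems by (simp add: letters_inv)
  finally show ?case by simp
qed

lemma signs_word_value:
  assumes n: "multiplicative_upto n" and w: "w \<in> lists letters" "length w \<le> n"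
    and a: "a \<in> signs Q (word_value Q w)"
  obtains w' where "w' \<in> lists letters" "length w' = length w" "a = word_value Q w'"
proof (cases "a = word_value Q w")
  case True
  then show ?thesis using that w by blast
next
  case False
  then have "a = word_value Q (map (loop_inv Q) (rev w))"
    using a inv_word_value[OF n w] by (simp add: signs_def)
  moreover have "map (loop_inv Q) (rev w) \<in> lists letters" using w by (auto simp: letters_inv)
  ultimately show ?thesis using that[of "map (loop_inv Q) (rev w)"] by simp
qed

lemma associates_word_values:
  assumes n: "multiplicative_upto n"
    and u: "u \<in> lists letters" and v: "v \<in> lists letters" and w: "w \<in> lists letters"
    and len: "length u + length v + length w \<le> n"
  shows "associates Q (word_value Q u) (word_value Q v) (word_value Q w)"
proof -
  have "word_value Q u \<otimes> (word_value Q v \<otimes> word_value Q w) = word_value Q (u @ v @ w)"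
    using multiplicative_uptoD[OF n u, of "v @ w"] multiplicative_uptoD[OF n v w] v w len by simp
  moreover have "(word_value Q u \<otimes> word_value Q v) \<otimes> word_value Q w = word_value Q ((u @ v) @ w)"
    using multiplicative_uptoD[OF n _ w, of "u @ v"] multiplicative_uptoD[OF n u v] u v len by simp
  ultimately show ?thesis by (simp add: associates_def)
qed

lemma SA_word_values:
  assumes n: "multiplicative_upto n"
    and u: "u \<in> lists letters" and v: "v \<in> lists letters" and w: "w \<in> lists letters"
    and len: "length u + length v + length w \<le> n"
  shows "SA Q (word_value Q u) (word_value Q v) (word_value Q w)"
proof (rule SA_intro)
  fix a b c
  assume a: "a \<in> signs Q (word_value Q u)" and b: "b \<in> signs Q (word_value Q v)"
    and c: "c \<in> signs Q (word_value Q w)"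
  obtain u' where u': "u' \<in> lists letters" "length u' = length u" "a = word_value Q u'"
    using signs_word_value[OF n u _ a] len by auto
  obtain v' where v': "v' \<in> lists letters" "length v' = length v" "b = word_value Q v'"
    using signs_word_value[OF n v _ b] len by auto
  obtain w' where w': "w' \<in> lists letters" "length w' = length w" "c = word_value Q w'"
    using signs_word_value[OF n w _ c] len by auto
  show "associates Q a b c \<and> associates Q a c b \<and> associates Q b a c \<and>
    associates Q b c a \<and> associates Q c a b \<and> associates Q c b a"
    using u' v' w' len by (simp add: associates_word_values[OF n])
qed (use u v w in \<open>auto intro: word_value_closed\<close>)

text \<open>
  The total length is fixed and the induction is on the left factor: if the related pair consists of
  the two last letters, the cut between the factors only moves one place to the left.
\<close>

lemma multiplicative_Suc:
  assumes n: "multiplicative_upto n"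
    and u: "u \<in> lists letters" and v: "v \<in> lists letters" and len: "length u + length v = Suc n"
  shows "word_value Q (u @ v) = word_value Q u \<otimes> word_value Q v"
  using u v len
proof (induction u arbitrary: v rule: rev_induct)
  case Nil
  then show ?case by (simp add: one_mult word_value_closed)
next
  case (snoc q u)
  have q: "q \<in> letters" and u: "u \<in> lists letters" and v: "v \<in> lists letters"
    using snoc.prems by auto
  note closed = word_value_closed[OF u] word_value_closed[OF v] letters_closed[OF q]
  have val1: "word_value Q [a] = a" if "a \<in> letters" for a
    using that by (simp add: mult_one letters_closed)
  show ?case
  proof (cases "u = [] \<or> v = []")
    case True
    then show ?thesis
    proof
      assume "u = []"
      then show ?thesis using closed by (simp add: mult_one)
    next
      assume "v = []"
      then show ?thesis using word_value_closed[of "u @ [q]"] snoc.prems by (simp add: mult_one)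
    qed
  next
    case False
    obtain p u' where pu: "u = p # u'" using False by (cases u) auto
    obtain v' r where vr: "v = v' @ [r]" using False by (cases v rule: rev_cases) auto
    have p: "p \<in> letters" and u': "u' \<in> lists letters" using u pu by auto
    have r: "r \<in> letters" and v': "v' \<in> lists letters" using v vr by auto
    have uq': "u' @ [q] \<in> lists letters" using u' q by simp
    have len': "length u' + length v' + 2 = n" using snoc.prems(3) pu vr by simp
    have val_v: "word_value Q v = word_value Q v' \<otimes> r"
      using multiplicative_uptoD[OF n v', of "[r]"] r len' vr val1 by simp
    have val_uq': "word_value Q (u' @ [q]) = word_value Q u' \<otimes> q"
      using multiplicative_uptoD[OF n u', of "[q]"] q len' val1 by simp
    have closed': "p \<in> carrier Q" "r \<in> carrier Q" "word_value Q u' \<in> carrier Q"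
      "word_value Q v' \<in> carrier Q" "word_value Q (u' @ [q]) \<in> carrier Q"
      using p r u' v' uq' by (simp_all add: letters_closed word_value_closed del: in_lists_conv_set)
    \<comment> \<open>Once the first letter can be split off, what remains has total length \<open>n\<close>.\<close>
    have first: ?thesis if "associates Q p (word_value Q (u' @ [q])) (word_value Q v)"
    proof -
      have "word_value Q ((u @ [q]) @ v) = p \<otimes> word_value Q ((u' @ [q]) @ v)"
        using pu by simp
      also have "\<dots> = p \<otimes> (word_value Q (u' @ [q]) \<otimes> word_value Q v)"
        using multiplicative_uptoD[OF n uq' v] len' vr by simp
      also have "\<dots> = (p \<otimes> word_value Q (u' @ [q])) \<otimes> word_value Q v"
        using that by (simp add: associates_def)
      finally show ?thesis using pu by simp
    qed
    consider "q \<in> signs Q p" | "r \<in> signs Q p" | "r \<in> signs Q q"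
      using letters_pigeonhole[OF p q r] by blast
    then show ?thesis
    proof cases
      \<comment> \<open>The letter \<open>q\<close> is dropped from the left factor and put back next to \<open>u'\<close>.\<close>
      case 1
      have "SA Q (word_value Q v) p (word_value Q u')"
        using SA_word_values[OF n v _ u', of "[p]"] p len' vr val1 by simp
      then have "SA Q (word_value Q v) p (word_value Q (u' @ [q]))"
        using SA_step_right closed closed' 1 val_uq' by simp
      then show ?thesis using SA_rotate SA_associates first by blast
    next
      \<comment> \<open>The letter \<open>r\<close> is dropped from the right factor and put back as \<open>p\<close> up to sign.\<close>
      case 2
      have "SA Q (word_value Q (u' @ [q])) p (word_value Q v')"
        using SA_word_values[OF n uq' _ v', of "[p]"] p len' val1 by simp
      then have "SA Q (word_value Q (u' @ [q])) p (word_value Q v)"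
        using SA_step_right closed closed' 2 val_v by simp
      then show ?thesis using SA_swap SA_associates first by blast
    next
      \<comment> \<open>Here \<open>r\<close> is put back as \<open>q\<close> up to sign, and \<open>q\<close> moves across the cut.\<close>
      case 3
      have "SA Q (word_value Q u) q (word_value Q v')"
        using SA_word_values[OF n u _ v', of "[q]"] q len' pu val1 by simp
      then have "SA Q (word_value Q u) q (word_value Q v)"
        using SA_step_right closed closed' 3 val_v by simp
      then have "word_value Q u \<otimes> word_value Q (q # v) = (word_value Q u \<otimes> q) \<otimes> word_value Q v"
        using SA_associates by (simp add: associates_def)
      moreover have "word_value Q (u @ (q # v)) = word_value Q u \<otimes> word_value Q (q # v)"
        using snoc.IH[of "q # v"] u v q snoc.prems(3) by simp
      moreover have "word_value Q (u @ [q]) = word_value Q u \<otimes> q"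
        using multiplicative_uptoD[OF n u, of "[q]"] q len' pu val1 by simp
      ultimately show ?thesis by simp
    qed
  qed
qed

lemma multiplicative: "multiplicative_upto n"
proof (induction n)
  case 0
  then show ?case by (simp add: multiplicative_upto_def one_mult one_closed)
next
  case (Suc n)
  then show ?case
    using multiplicative_Suc[OF Suc] by (auto simp: multiplicative_upto_def le_Suc_eq simp del: in_lists_conv_set)
qed

lemma word_value_append:
  "\<lbrakk>u \<in> lists letters; v \<in> lists letters\<rbrakk> \<Longrightarrow>
    word_value Q (u @ v) = word_value Q u \<otimes> word_value Q v"
  using multiplicative multiplicative_uptoD by blast

lemma inv_word_value_mem:
  "w \<in> lists letters \<Longrightarrow> loop_inv Q (word_value Q w) \<in> word_value Q ` lists letters"
  using inv_word_value[OF multiplicative, of w "length w"]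
  by (force simp: letters_inv)

lemma subloop_word_values: "subloop (word_value Q ` lists letters) Q"
proof -
  let ?H = "word_value Q ` lists letters"
  have mult: "a \<otimes> b \<in> ?H" if ab: "a \<in> ?H" "b \<in> ?H" for a b
  proof -
    obtain u v where "u \<in> lists letters" "a = word_value Q u" "v \<in> lists letters" "b = word_value Q v"
      using ab by blast
    then show ?thesis by (metis append_in_lists_conv image_eqI word_value_append)
  qed
  have inv: "loop_inv Q a \<in> ?H" if "a \<in> ?H" for a
    using that inv_word_value_mem by blast
  have sub: "?H \<subseteq> carrier Q" using word_value_closed by blast
  have one: "\<one> \<in> ?H" by (rule image_eqI[of _ _ "[]"]) simp_all
  show ?thesis
    unfolding subloop_def
  proof (intro conjI ballI sub one)
    fix a b assume ab: "a \<in> ?H" "b \<in> ?H"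
    then have ab': "a \<in> carrier Q" "b \<in> carrier Q" using sub by auto
    show "a \<otimes> b \<in> ?H" "a \<setminus> b \<in> ?H" "a \<oslash> b \<in> ?H"
      using ab mult inv by (simp_all add: ldiv_eq rdiv_eq ab')
  qed
qed

lemma generated_subloop_le: "generated_subloop Q {x, y} \<subseteq> word_value Q ` lists letters"
proof -
  have "z \<in> word_value Q ` lists letters" if "z \<in> {x, y}" for z
    using that x y by (intro image_eqI[of _ _ "[z]"]) (auto simp: mult_one letters_def signs_def)
  then show ?thesis
    using subloop_word_values by (auto simp: generated_subloop_def)
qed

lemma word_values_associate:
  assumes "a \<in> word_value Q ` lists letters" "b \<in> word_value Q ` lists letters"
    "c \<in> word_value Q ` lists letters"
  shows "(a \<otimes> b) \<otimes> c = a \<otimes> (b \<otimes> c)"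
proof -
  obtain u v w where "u \<in> lists letters" "v \<in> lists letters" "w \<in> lists letters"
    and "a = word_value Q u" "b = word_value Q v" "c = word_value Q w"
    using assms by blast
  then show ?thesis
    using associates_word_values[OF multiplicative _ _ _ order_refl, of u v w]
    by (simp add: associates_def)
qed

lemma group_generated: "group (Q\<lparr>carrier := generated_subloop Q {x, y}\<rparr>)"
proof -
  let ?G = "generated_subloop Q {x, y}"
  have sub: "?G \<subseteq> word_value Q ` lists letters" by (rule generated_subloop_le)
  then have carrier: "?G \<subseteq> carrier Q" using word_value_closed by blast
  have mult: "a \<otimes> b \<in> ?G" and ldiv: "a \<setminus> b \<in> ?G" if "a \<in> ?G" "b \<in> ?G" for a b
    using that by (auto simp: generated_subloop_def subloop_def)
  have one: "\<one> \<in> ?G" by (auto simp: generated_subloop_def subloop_def)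
  show ?thesis
  proof (rule groupI)
    fix a assume "a \<in> carrier (Q\<lparr>carrier := ?G\<rparr>)"
    then have a: "a \<in> ?G" by simp
    then have "loop_inv Q a \<in> ?G" using ldiv one by (simp add: loop_inv_def)
    moreover have "loop_inv Q a \<otimes> a = \<one>" using a carrier inv_mult by blast
    ultimately show "\<exists>b\<in>carrier (Q\<lparr>carrier := ?G\<rparr>).
        b \<otimes>\<^bsub>Q\<lparr>carrier := ?G\<rparr>\<^esub> a = \<one>\<^bsub>Q\<lparr>carrier := ?G\<rparr>\<^esub>"
      by auto
  next
    fix a b c
    assume "a \<in> carrier (Q\<lparr>carrier := ?G\<rparr>)" "b \<in> carrier (Q\<lparr>carrier := ?G\<rparr>)"
      "c \<in> carrier (Q\<lparr>carrier := ?G\<rparr>)"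
    then show "a \<otimes>\<^bsub>Q\<lparr>carrier := ?G\<rparr>\<^esub> b \<otimes>\<^bsub>Q\<lparr>carrier := ?G\<rparr>\<^esub> c =
        a \<otimes>\<^bsub>Q\<lparr>carrier := ?G\<rparr>\<^esub> (b \<otimes>\<^bsub>Q\<lparr>carrier := ?G\<rparr>\<^esub> c)"
      using word_values_associate sub by (simp add: subset_iff)
  next
    fix a assume "a \<in> carrier (Q\<lparr>carrier := ?G\<rparr>)"
    then show "\<one>\<^bsub>Q\<lparr>carrier := ?G\<rparr>\<^esub> \<otimes>\<^bsub>Q\<lparr>carrier := ?G\<rparr>\<^esub> a = a"
      using carrier one_mult by auto
  qed (use mult one in auto)
qed

end

theorem lemma6p6:
  fixes Q :: "('a, 'b) loop_scheme"
  assumes "stepping_up_loop Q"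
  shows "diassociative Q"
  unfolding diassociative_def
proof (intro ballI)
  fix x y assume "x \<in> carrier Q" "y \<in> carrier Q"
  then interpret two_generators Q x y
    using assms by (simp add: two_generators_def two_generators_axioms_def)
  show "group (Q\<lparr>carrier := generated_subloop Q {x, y}\<rparr>)" by (rule group_generated)
qed

end
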